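(* For $t\in[0,1]$ and density matrices $\rho_i,\sigma_i$ of size $n_i\times n_i$ ($i=1,2$), $$\mathsf{F}_t^{\mathrm{spec}}(\rho_1\otimes\rho_2,\ \sigma_1\otimes\sigma_2)=\mathsf{F}_t^{\mathrm{spec}}(\rho_1,\sigma_1)\,\mathsf{F}_t^{\mathrm{spec}}(\rho_2,\sigma_2).$$ Equivalently, $-\log \mathsf{F}_t^{\mathrm{spec}}$ is additive under tensor products.
   Context: A density matrix (density operator, state) is a positive semidefinite complex square matrix of trace one. For positive definite $A,B$, the matrix geometric mean is $A\sharp B=A^{1/2}(A^{-1/2}BA^{-1/2})^{1/2}A^{1/2}$, and the weighted spectral fidelity is $\mathsf{F}_t^{\mathrm{spec}}(\rho,\sigma)=\operatorname{Tr}\big(\rho\,(\rho^{-1}\sharp\sigma)^{2t}\big)$ for $t\in[0,1]$. Explicitly $\rho^{-1}\sharp\sigma=\rho^{-1/2}(\rho^{1/2}\sigma\rho^{1/2})^{1/2}\rho^{-1/2}$; for singular states this formula is used with inverse and fractional powers interpreted on the support of the corresponding operator (zero on its kernel), and $X^0=I$. *)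

theory Defs
  imports "HOL-Analysis.Analysis"
begin

definition conj_transpose :: "complex^'n^'m \<Rightarrow> complex^'m^'n" where
  "conj_transpose A = (\<chi> i j. cnj (A $ j $ i))"

definition unitary_matrix :: "complex^'n^'n \<Rightarrow> bool" where
  "unitary_matrix U \<longleftrightarrow> conj_transpose U ** U = mat 1 \<and> U ** conj_transpose U = mat 1"

text \<open>The order on \<^typ>\<open>complex\<close> is that of \<^theory>\<open>HOL-Library.Complex_Order\<close>:
  \<^prop>\<open>0 \<le> (z :: complex)\<close> says that \<^term>\<open>z\<close> is real and nonnegative.\<close>

definition positive_semidefinite :: "complex^'n^'n \<Rightarrow> bool" where
  "positive_semidefinite A \<longleftrightarrow> conj_transpose A = A \<and>
     (\<forall>v. 0 \<le> (\<Sum>i\<in>UNIV. \<Sum>j\<in>UNIV. cnj (v $ i) * A $ i $ j * v $ j))"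

definition density_matrix :: "complex^'n^'n \<Rightarrow> bool" where
  "density_matrix \<rho> \<longleftrightarrow> positive_semidefinite \<rho> \<and> trace \<rho> = 1"

definition real_diag :: "('n \<Rightarrow> real) \<Rightarrow> complex^'n^'n" where
  "real_diag d = (\<chi> i j. if i = j then complex_of_real (d i) else 0)"

text \<open>Functional calculus for Hermitian matrices: \<^term>\<open>f\<close> is applied to the eigenvalues in
  a unitary diagonalization. The result does not depend on the diagonalization, see
  \<open>hermitian_fun_eqI\<close> below.\<close>

definition hermitian_fun :: "(real \<Rightarrow> real) \<Rightarrow> complex^'n^'n \<Rightarrow> complex^'n^'n" where
  "hermitian_fun f A = (THE B. \<exists>U d. unitary_matrix U \<and>
     A = U ** real_diag d ** conj_transpose U \<and>
     B = U ** real_diag (f \<circ> d) ** conj_transpose U)"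

lemma hermitian_fun_unique:
  fixes U V :: "complex^'n^'n"
  assumes U: "unitary_matrix U" and V: "unitary_matrix V"
    and eq: "U ** real_diag d ** conj_transpose U = V ** real_diag e ** conj_transpose V"
  shows "U ** real_diag (f \<circ> d) ** conj_transpose U = V ** real_diag (f \<circ> e) ** conj_transpose V"
proof -
  define W where "W = conj_transpose V ** U"
  have UU: "conj_transpose U ** U = mat 1" "U ** conj_transpose U = mat 1"
    using U by (auto simp: unitary_matrix_def)
  have VV: "conj_transpose V ** V = mat 1" "V ** conj_transpose V = mat 1"
    using V by (auto simp: unitary_matrix_def)
  have right: "(W ** real_diag g) $ i $ j = W $ i $ j * of_real (g j)" for g i j
    by (simp add: matrix_matrix_mult_def real_diag_def if_distrib[of "\<lambda>x. _ * x"] cong: if_cong)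
  have left: "(real_diag g ** W) $ i $ j = of_real (g i) * W $ i $ j" for g i j
    by (simp add: matrix_matrix_mult_def real_diag_def if_distrib[of "\<lambda>x. x * _"] cong: if_cong)
  have "W ** real_diag d = conj_transpose V ** (U ** real_diag d ** conj_transpose U) ** U"
    unfolding W_def by (metis UU(1) matrix_mul_assoc matrix_mul_rid)
  also have "\<dots> = real_diag e ** W"
    unfolding eq W_def by (metis VV(1) matrix_mul_assoc matrix_mul_lid)
  finally have comm: "W ** real_diag d = real_diag e ** W" .
  have "W ** real_diag (f \<circ> d) = real_diag (f \<circ> e) ** W"
  proof (simp only: vec_eq_iff right left, intro allI)
    fix i j
    have "W $ i $ j * of_real (d j) = of_real (e i) * W $ i $ j"
      using comm left right by metis
    then have "W $ i $ j = 0 \<or> d j = e i" by (simp add: mult.commute)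
    then show "W $ i $ j * of_real ((f \<circ> d) j) = of_real ((f \<circ> e) i) * W $ i $ j" by auto
  qed
  then have "V ** (W ** real_diag (f \<circ> d)) ** conj_transpose U
      = V ** (real_diag (f \<circ> e) ** W) ** conj_transpose U" by simp
  moreover have "V ** (W ** real_diag (f \<circ> d)) ** conj_transpose U
      = U ** real_diag (f \<circ> d) ** conj_transpose U"
    unfolding W_def by (metis VV(2) matrix_mul_assoc matrix_mul_lid)
  moreover have "V ** (real_diag (f \<circ> e) ** W) ** conj_transpose U
      = V ** real_diag (f \<circ> e) ** conj_transpose V"
    unfolding W_def by (metis UU(2) matrix_mul_assoc matrix_mul_rid)
  ultimately show ?thesis by simp
qed

lemma hermitian_fun_eqI:
  assumes "unitary_matrix U" and "A = U ** real_diag d ** conj_transpose U"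
  shows "hermitian_fun f A = U ** real_diag (f \<circ> d) ** conj_transpose U"
  unfolding hermitian_fun_def
proof (rule the_equality)
  fix B assume "\<exists>V e. unitary_matrix V \<and> A = V ** real_diag e ** conj_transpose V \<and>
     B = V ** real_diag (f \<circ> e) ** conj_transpose V"
  then show "B = U ** real_diag (f \<circ> d) ** conj_transpose U"
    using hermitian_fun_unique[of _ U] assms by metis
qed (use assms in blast)

text \<open>Real powers of a positive semidefinite matrix. Since \<^term>\<open>0 powr s = (0 :: real)\<close> for
  every \<^term>\<open>s\<close>, powers with \<^prop>\<open>s \<noteq> 0\<close>, negative ones included, are taken on
  the support and vanish on the kernel; the power with exponent 0 is the identity matrix.\<close>

definition psd_powr :: "complex^'n^'n \<Rightarrow> real \<Rightarrow> complex^'n^'n" where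
  "psd_powr A s = (if s = 0 then mat 1 else hermitian_fun (\<lambda>x. x powr s) A)"

text \<open>The matrix geometric mean of the inverse of \<open>\<rho>\<close> with \<open>\<sigma>\<close>, that is,
  \<open>A\<^sup>1\<^sup>/\<^sup>2 (A\<^sup>-\<^sup>1\<^sup>/\<^sup>2 \<sigma> A\<^sup>-\<^sup>1\<^sup>/\<^sup>2)\<^sup>1\<^sup>/\<^sup>2 A\<^sup>1\<^sup>/\<^sup>2\<close> at \<open>A = \<rho>\<^sup>-\<^sup>1\<close>, in the form that also makes sense
  for singular \<open>\<rho>\<close>.\<close>

definition inverse_geometric_mean :: "complex^'n^'n \<Rightarrow> complex^'n^'n \<Rightarrow> complex^'n^'n" where
  "inverse_geometric_mean \<rho> \<sigma> =
     psd_powr \<rho> (-1/2) ** psd_powr (psd_powr \<rho> (1/2) ** \<sigma> ** psd_powr \<rho> (1/2)) (1/2)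
       ** psd_powr \<rho> (-1/2)"

definition spectral_fidelity :: "real \<Rightarrow> complex^'n^'n \<Rightarrow> complex^'n^'n \<Rightarrow> complex" where
  "spectral_fidelity t \<rho> \<sigma> = trace (\<rho> ** psd_powr (inverse_geometric_mean \<rho> \<sigma>) (2 * t))"

text \<open>The fidelity of two states is a nonnegative real number, being the trace of a product of
  positive semidefinite matrices. It may vanish, in which case \<open>-log\<close> of it is \<open>\<infinity>\<close>.\<close>

definition neg_log_spectral_fidelity :: "real \<Rightarrow> complex^'n^'n \<Rightarrow> complex^'n^'n \<Rightarrow> ereal" where
  "neg_log_spectral_fidelity t \<rho> \<sigma> =
     (if spectral_fidelity t \<rho> \<sigma> = 0 then \<infinity>
      else ereal (- ln (Re (spectral_fidelity t \<rho> \<sigma>))))"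

text \<open>The Kronecker product; its rows and columns are indexed by pairs of indices.\<close>

definition kronecker :: "complex^'n^'n \<Rightarrow> complex^'m^'m \<Rightarrow> complex^('n \<times> 'm)^('n \<times> 'm)"
    (infixl "\<otimes>\<^sub>K" 70) where
  "A \<otimes>\<^sub>K B = (\<chi> i j. A $ fst i $ fst j * B $ snd i $ snd j)"

end

theory Submission
  imports Defs
begin

text \<open>Every ingredient of the spectral fidelity respects the Kronecker product. The product of
  matrices does, by \<^term>\<open>(A \<otimes>\<^sub>K B) ** (C \<otimes>\<^sub>K D) = (A ** C) \<otimes>\<^sub>K (B ** D)\<close>, and so does the
  trace. Fractional powers do as well: if \<open>U\<close> and \<open>V\<close> diagonalize the Hermitian matrices \<open>A\<close> and
  \<open>B\<close>, then \<open>U \<otimes> V\<close> is unitary and diagonalizes \<open>A \<otimes> B\<close>, whose eigenvalues are the products of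
  an eigenvalue of \<open>A\<close> and one of \<open>B\<close>. Functional calculus with a multiplicative function such as
  \<open>x \<mapsto> x\<^sup>s\<close> therefore commutes with the Kronecker product (\<open>hermitian_fun_kronecker\<close>). This
  covers singular matrices: \<open>0 powr s = 0\<close> is compatible with multiplicativity, which expresses
  that the support of a Kronecker product is the Kronecker product of the supports. Going through
  the formula for the fidelity from the inside outwards gives its multiplicativity
  (\<open>spectral_fidelity_kronecker\<close>), once it is known that each matrix to which a power is applied
  is Hermitian.

  Diagonalizations come from the spectral theorem for Hermitian matrices, which is proved
  variationally: the maximum of the quadratic form on the unit sphere of an invariant subspace is
  attained at an eigenvector, so an orthonormal set of eigenvectors of largest size has
  no nonzero vector orthogonal to it.

  For the logarithm the fidelities have to be nonnegative reals
  (\<open>spectral_fidelity_nonneg\<close>): complex factors could have a nonreal product of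
  which the real part is not the product of the real parts.\<close>

section \<open>The Hermitian inner product\<close>

text \<open>The standard inner product of \<open>\<complex>\<^sup>n\<close>, conjugate linear in the first argument; its
  real part is \<^const>\<open>inner\<close>.\<close>

definition herm_inner :: "complex^'n \<Rightarrow> complex^'n \<Rightarrow> complex" where
  "herm_inner x y = (\<Sum>i\<in>UNIV. cnj (x $ i) * y $ i)"

lemma herm_inner_linear:
  "herm_inner x (y + z) = herm_inner x y + herm_inner x z"
  "herm_inner x (y - z) = herm_inner x y - herm_inner x z"
  "herm_inner x (c *s y) = c * herm_inner x y"
  "herm_inner x 0 = 0"
  by (simp_all add: herm_inner_def algebra_simps sum.distrib sum_subtractf sum_distrib_left)

lemma herm_inner_sum: "herm_inner x (\<Sum>s\<in>S. f s) = (\<Sum>s\<in>S. herm_inner x (f s))"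
  by (induction S rule: infinite_finite_induct) (simp_all add: herm_inner_linear)

lemma herm_inner_commute: "cnj (herm_inner x y) = herm_inner y x"
  by (simp add: herm_inner_def mult.commute)

lemma Re_herm_inner: "Re (herm_inner x y) = inner x y"
  by (simp add: herm_inner_def inner_vec_def inner_complex_def)

lemma herm_inner_self: "herm_inner x x = of_real ((norm x)\<^sup>2)"
  using Re_herm_inner[of x x] herm_inner_commute[of x x]
  by (simp add: complex_eq_iff power2_norm_eq_inner)

lemma herm_inner_adjoint: "herm_inner x (A *v y) = herm_inner (conj_transpose A *v x) y"
proof -
  have "herm_inner x (A *v y) = (\<Sum>i\<in>UNIV. \<Sum>j\<in>UNIV. cnj (x $ i) * (A $ i $ j * y $ j))"
    by (simp add: herm_inner_def matrix_vector_mult_def sum_distrib_left)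
  also have "\<dots> = (\<Sum>j\<in>UNIV. \<Sum>i\<in>UNIV. cnj (x $ i) * (A $ i $ j * y $ j))"
    by (rule sum.swap)
  also have "\<dots> = herm_inner (conj_transpose A *v x) y"
    by (simp add: herm_inner_def matrix_vector_mult_def conj_transpose_def sum_distrib_left
        sum_distrib_right mult_ac)
  finally show ?thesis .
qed

lemma inner_hermitian:
  assumes "conj_transpose A = A"
  shows "inner x (A *v y) = inner (A *v x) y"
  by (metis Re_herm_inner assms herm_inner_adjoint)

section \<open>The spectral theorem for Hermitian matrices\<close>

lemma mult_real_diag: "(A ** real_diag d) $ i $ j = A $ i $ j * of_real (d j)"
  by (simp add: matrix_matrix_mult_def real_diag_def if_distrib[of "\<lambda>x. _ * x"] cong: if_cong)

text \<open>Near \<open>0\<close> the linear term dominates the quadratic one, so it would produce negative values.\<close>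

lemma quadratic_nonneg_imp_linear_term_0:
  fixes b c :: real
  assumes "\<And>s. 0 \<le> 2 * s * b + s\<^sup>2 * c"
  shows "b = 0"
proof (rule ccontr)
  assume "b \<noteq> 0"
  \<comment> \<open>At \<open>s = - b / k\<close> the value is \<open>b\<^sup>2 (c - 2 k) / k\<^sup>2\<close>, negative as soon as \<open>2 k > c\<close>.\<close>
  define k where "k = 1 + \<bar>c\<bar>"
  have k: "k > 0" unfolding k_def by auto
  have "0 \<le> 2 * (- b / k) * b + (- b / k)\<^sup>2 * c" by (rule assms)
  also have "\<dots> = b\<^sup>2 * (c - 2 * k) / k\<^sup>2"
    using k by (simp add: field_simps power2_eq_square)
  finally have "0 \<le> b\<^sup>2 * (c - 2 * k)"
    using k by (simp add: zero_le_divide_iff)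
  moreover have "c - 2 * k < 0" unfolding k_def by auto
  ultimately show False using \<open>b \<noteq> 0\<close>
    by (simp add: zero_le_mult_iff)
qed

lemma complex_matrix_vector_mult_scaleR: "A *v (r *\<^sub>R y) = r *\<^sub>R (A *v y)" for A :: "complex^'n^'m"
  by (simp add: matrix_vector_mult_def vec_eq_iff scaleR_sum_right)

text \<open>The Rayleigh quotient attains its maximum \<open>l\<close> on the compact unit sphere of \<open>W\<close>, at \<open>v\<close>
  say. Then \<open>l |x|\<^sup>2 - \<langle>x, A x\<rangle>\<close> is nonnegative on \<open>W\<close> and vanishes at \<open>v\<close>. Its first
  variation at \<open>v\<close> in the direction of the residual \<open>l v - A v\<close>, which lies in \<open>W\<close> by invariance,
  is twice the squared norm of that residual; so the residual is \<open>0\<close>.\<close>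

lemma hermitian_eigenvector_in_subspace:
  fixes A :: "complex^'n^'n"
  assumes herm: "conj_transpose A = A" and W: "subspace W" and inv: "\<And>x. x \<in> W \<Longrightarrow> A *v x \<in> W"
    and ne: "w \<in> W" "w \<noteq> 0"
  obtains v l where "v \<in> W" "norm v = 1" "A *v v = of_real l *s v"
proof -
  let ?q = "\<lambda>x. inner x (A *v x)"
  have "compact (sphere 0 1 \<inter> W)"
    by (intro compact_Int_closed closed_subspace W) auto
  moreover have "(1 / norm w) *\<^sub>R w \<in> sphere 0 1 \<inter> W"
    using ne W by (auto intro: subspace_mul)
  then have "sphere 0 1 \<inter> W \<noteq> {}" by blast
  moreover have "continuous_on (sphere 0 1 \<inter> W) ?q"
    by (intro continuous_intros)
  ultimately obtain v where v: "v \<in> sphere 0 1 \<inter> W" and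
    vmax: "\<And>x. x \<in> sphere 0 1 \<inter> W \<Longrightarrow> ?q x \<le> ?q v"
    using continuous_attains_sup[of "sphere 0 1 \<inter> W" ?q] by blast
  define l where "l = ?q v"
  have q_le: "?q x \<le> l * inner x x" if "x \<in> W" for x
  proof (cases "x = 0")
    case False
    have "(1 / norm x) *\<^sub>R x \<in> sphere 0 1 \<inter> W"
      using False that W by (auto intro: subspace_mul)
    from vmax[OF this] have "?q x / (norm x)\<^sup>2 \<le> l"
      by (simp add: complex_matrix_vector_mult_scaleR l_def power2_eq_square)
    then show ?thesis using False by (simp add: field_simps power2_norm_eq_inner)
  qed simp
  define y where "y = l *\<^sub>R v - A *v v"
  have y: "y \<in> W" unfolding y_def using v W inv by (auto intro: subspace_diff subspace_mul)
  have "inner y y = 0"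
  proof (rule quadratic_nonneg_imp_linear_term_0)
    fix s :: real
    have "v + s *\<^sub>R y \<in> W" using v y W by (auto intro: subspace_add subspace_mul)
    from q_le[OF this]
    have "0 \<le> l * inner (v + s *\<^sub>R y) (v + s *\<^sub>R y) - ?q (v + s *\<^sub>R y)" by simp
    also have "\<dots> = (l * inner v v - ?q v) + 2 * s * (l * inner y v - inner y (A *v v))
        + s\<^sup>2 * (l * inner y y - ?q y)"
      using inner_hermitian[OF herm, of v y]
      by (simp add: matrix_vector_right_distrib complex_matrix_vector_mult_scaleR inner_commute
          algebra_simps power2_eq_square)
    also have "l * inner v v - ?q v = 0"
      using v by (simp add: l_def flip: power2_norm_eq_inner)
    also have "l * inner y v - inner y (A *v v) = inner y y"
      unfolding y_def by (simp add: algebra_simps)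
    finally show "0 \<le> 2 * s * inner y y + s\<^sup>2 * (l * inner y y - ?q y)" by simp
  qed
  then have "A *v v = l *\<^sub>R v" unfolding y_def by simp
  moreover have "l *\<^sub>R v = of_real l *s v"
    by (simp add: vec_eq_iff complex_eq_iff)
  ultimately have "A *v v = of_real l *s v" by simp
  then show ?thesis using that v by auto
qed

lemma orthonormal_independent:
  assumes "\<And>x y. x \<in> S \<Longrightarrow> y \<in> S \<Longrightarrow> herm_inner x y = (if x = y then 1 else 0)"
  shows "vec.independent S"
  unfolding vec.dependent_explicit
proof safe
  fix T u v assume T: "finite T" "T \<subseteq> S" "(\<Sum>x\<in>T. u x *s x) = 0" "v \<in> T" "u v \<noteq> 0"
  have "0 = herm_inner v (\<Sum>x\<in>T. u x *s x)" using T by (simp add: herm_inner_linear)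
  also have "\<dots> = (\<Sum>x\<in>T. if v = x then u x else 0)"
    unfolding herm_inner_sum herm_inner_linear using assms[of v] T(2,4)
    by (intro sum.cong) (auto simp: subset_iff)
  also have "\<dots> = u v" using T by simp
  finally show False using T by simp
qed

text \<open>Take an orthonormal set \<open>S\<close> of eigenvectors that has the largest possible size; sizes are
  bounded by the dimension, since orthonormal sets are independent. The orthogonal complement of
  \<open>S\<close> is invariant because \<open>A\<close> is Hermitian, so if it were not zero, it would contain a unit
  eigenvector by which \<open>S\<close> could be enlarged. Hence \<open>S\<close> spans, and its size is the
  dimension.\<close>

lemma hermitian_orthonormal_eigenbasis:
  fixes A :: "complex^'n^'n"
  assumes herm: "conj_transpose A = A"
  obtains S where "card S = CARD('n)"
    "\<And>x y. x \<in> S \<Longrightarrow> y \<in> S \<Longrightarrow> herm_inner x y = (if x = y then 1 else 0)"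
    "\<And>x. x \<in> S \<Longrightarrow> \<exists>l. A *v x = of_real l *s x"
proof -
  define P where "P S \<longleftrightarrow> (\<forall>x\<in>S. \<forall>y\<in>S. herm_inner x y = (if x = y then 1 else 0)) \<and>
    (\<forall>x\<in>S. \<exists>l. A *v x = of_real l *s x)" for S
  have indep: "vec.independent S" if "P S" for S
    using that orthonormal_independent unfolding P_def by blast
  have fin: "finite S" if "P S" for S
    using indep[OF that] by (rule vec.finiteI_independent)
  have card_le: "card S \<le> CARD('n)" if "P S" for S
    using vec.independent_card_le_dim[OF subset_UNIV indep[OF that]]
    by (simp add: vec_dim_card del: vec.dim_UNIV)
  have "P {}" by (simp add: P_def)
  moreover have "\<forall>S. P S \<longrightarrow> card S < Suc CARD('n)" using card_le by (simp add: less_Suc_eq_le)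
  ultimately obtain S where S: "P S" and Smax: "\<And>T. P T \<Longrightarrow> card T \<le> card S"
    using ex_has_greatest_nat[of P "{}" card "Suc CARD('n)"] by auto
  have ortho: "herm_inner x y = (if x = y then 1 else 0)" if "x \<in> S" "y \<in> S" for x y
    using S that unfolding P_def by blast
  have eig: "\<exists>l. A *v x = of_real l *s x" if "x \<in> S" for x
    using S that unfolding P_def by blast
  define W where "W = {x. \<forall>s\<in>S. herm_inner s x = 0}"
  have W0: "w = 0" if "w \<in> W" for w
  proof (rule ccontr)
    assume "w \<noteq> 0"
    have scale: "herm_inner s (c *\<^sub>R x) = c *\<^sub>R herm_inner s x" for s x c
      by (simp add: herm_inner_def scaleR_sum_right)
    have "subspace W"
      by (auto simp: subspace_def W_def herm_inner_linear scale)
    moreover have "A *v x \<in> W" if "x \<in> W" for x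
    proof -
      have "herm_inner s (A *v x) = 0" if "s \<in> S" for s
      proof -
        obtain l where "A *v s = of_real l *s s" using eig[OF \<open>s \<in> S\<close>] by blast
        then have "herm_inner s (A *v x) = herm_inner (of_real l *s s) x"
          by (simp add: herm_inner_adjoint herm)
        also have "\<dots> = cnj (of_real l * herm_inner x s)"
          by (metis herm_inner_commute herm_inner_linear(3))
        also have "\<dots> = of_real l * herm_inner s x" by (simp add: herm_inner_commute)
        finally show ?thesis using \<open>x \<in> W\<close> that by (simp add: W_def)
      qed
      then show ?thesis by (simp add: W_def)
    qed
    ultimately obtain v l where v: "v \<in> W" "norm v = 1" "A *v v = of_real l *s v"
      using hermitian_eigenvector_in_subspace[OF herm] \<open>w \<in> W\<close> \<open>w \<noteq> 0\<close> by blast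
    have vv: "herm_inner v v = 1" using v by (simp add: herm_inner_self)
    have sv: "herm_inner s v = 0" "herm_inner v s = 0" if "s \<in> S" for s
      using v(1) that herm_inner_commute[of s v] by (auto simp: W_def)
    have "v \<notin> S" using sv vv by auto
    moreover have "P (insert v S)"
      using S vv sv v(3) \<open>v \<notin> S\<close> unfolding P_def by auto
    ultimately show False using Smax[of "insert v S"] fin[OF S] by simp
  qed
  have "vec.span S = UNIV"
  proof safe
    fix x
    \<comment> \<open>The orthogonal projection of \<open>x\<close> to the span of \<open>S\<close>.\<close>
    define p where "p = (\<Sum>s\<in>S. herm_inner s x *s s)"
    have "x - p \<in> W"
    proof -
      have "herm_inner s p = herm_inner s x" if "s \<in> S" for s
      proof -
        have "herm_inner s p = (\<Sum>r\<in>S. if s = r then herm_inner r x else 0)"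
          unfolding p_def herm_inner_sum herm_inner_linear
          using ortho that by (intro sum.cong) auto
        then show ?thesis using that fin[OF S] by simp
      qed
      then show ?thesis by (simp add: W_def herm_inner_linear)
    qed
    then have "x = p" using W0 by fastforce
    moreover have "p \<in> vec.span S"
      unfolding p_def by (intro vec.span_sum vec.span_scale vec.span_base)
    ultimately show "x \<in> vec.span S" by metis
  qed simp
  then have "card S = CARD('n)"
    using vec.dim_eq_card[of S UNIV] indep[OF S] by (simp add: vec_dim_card del: vec.dim_UNIV)
  then show ?thesis using that ortho eig by blast
qed

text \<open>The columns of \<open>U\<close> are the vectors of an orthonormal eigenbasis, numbered by the index type.\<close>

lemma hermitian_diagonalization:
  fixes A :: "complex^'n^'n"
  assumes herm: "conj_transpose A = A"
  obtains U d where "unitary_matrix U" "A = U ** real_diag d ** conj_transpose U"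
proof -
  obtain S where S: "card S = CARD('n)"
    "\<And>x y. x \<in> S \<Longrightarrow> y \<in> S \<Longrightarrow> herm_inner x y = (if x = y then 1 else 0)"
    "\<And>x. x \<in> S \<Longrightarrow> \<exists>l. A *v x = of_real l *s x"
    using hermitian_orthonormal_eigenbasis[OF herm] by metis
  have "finite S" using S(1) by (metis card.infinite zero_less_card_finite less_irrefl)
  then obtain b :: "'n \<Rightarrow> complex^'n" where b: "bij_betw b UNIV S"
    using finite_same_card_bij[of "UNIV :: 'n set" S] S(1) by auto
  then have bS: "b k \<in> S" for k by (auto simp: bij_betw_def)
  have b_eq: "b k = b l \<longleftrightarrow> k = l" for k l
    using b by (auto simp: bij_betw_def inj_on_def)
  obtain d where d: "\<And>k. A *v b k = of_real (d k) *s b k"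
    using S(3)[OF bS] by metis
  define U :: "complex^'n^'n" where "U = (\<chi> i k. b k $ i)"
  have "conj_transpose U ** U = mat 1"
    using S(2)[OF bS bS, unfolded b_eq herm_inner_def]
    by (simp add: vec_eq_iff matrix_matrix_mult_def conj_transpose_def U_def mat_def)
  then have U: "unitary_matrix U"
    by (simp add: unitary_matrix_def matrix_left_right_inverse)
  have "A ** U = U ** real_diag d"
  proof (simp only: vec_eq_iff, intro allI)
    fix i k
    have "(A ** U) $ i $ k = (A *v b k) $ i"
      by (simp add: matrix_matrix_mult_def matrix_vector_mult_def U_def)
    also have "\<dots> = (U ** real_diag d) $ i $ k"
      by (simp add: d mult_real_diag U_def)
    finally show "(A ** U) $ i $ k = (U ** real_diag d) $ i $ k" .
  qed
  then have "A = U ** real_diag d ** conj_transpose U"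
    using U unfolding unitary_matrix_def by (metis matrix_mul_assoc matrix_mul_rid)
  with U that show ?thesis by blast
qed

section \<open>The adjoint and the Kronecker product\<close>

lemma conj_transpose_mult: "conj_transpose (A ** B) = conj_transpose B ** conj_transpose A"
  by (simp add: vec_eq_iff conj_transpose_def matrix_matrix_mult_def mult.commute)

lemma conj_transpose_conj_transpose: "conj_transpose (conj_transpose A) = A"
  by (simp add: vec_eq_iff conj_transpose_def)

lemma conj_transpose_real_diag: "conj_transpose (real_diag d) = real_diag d"
  by (simp add: vec_eq_iff conj_transpose_def real_diag_def)

lemma conj_transpose_kronecker:
  "conj_transpose (A \<otimes>\<^sub>K B) = conj_transpose A \<otimes>\<^sub>K conj_transpose B"
  by (simp add: vec_eq_iff conj_transpose_def kronecker_def)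

lemma sum_UNIV_prod:
  "(\<Sum>p\<in>(UNIV :: ('a::finite \<times> 'b::finite) set). f (fst p) * g (snd p))
    = (\<Sum>i\<in>UNIV. f i) * (\<Sum>j\<in>UNIV. g j :: complex)"
  by (simp add: sum_product sum.cartesian_product case_prod_unfold flip: UNIV_Times_UNIV)

lemma kronecker_mult: "(A \<otimes>\<^sub>K B) ** (C \<otimes>\<^sub>K D) = (A ** C) \<otimes>\<^sub>K (B ** D)"
  by (simp add: vec_eq_iff kronecker_def matrix_matrix_mult_def mult_ac flip: sum_UNIV_prod)

lemma trace_kronecker: "trace (A \<otimes>\<^sub>K B) = trace A * trace B"
  by (simp add: trace_def kronecker_def flip: sum_UNIV_prod)

lemma kronecker_mat_1: "mat 1 \<otimes>\<^sub>K mat 1 = mat 1"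
  by (auto simp: vec_eq_iff kronecker_def mat_def prod_eq_iff)

lemma kronecker_real_diag:
  "real_diag d \<otimes>\<^sub>K real_diag e = real_diag (\<lambda>p. d (fst p) * e (snd p))"
  by (auto simp: vec_eq_iff kronecker_def real_diag_def prod_eq_iff)

lemma unitary_matrix_kronecker:
  "unitary_matrix U \<Longrightarrow> unitary_matrix V \<Longrightarrow> unitary_matrix (U \<otimes>\<^sub>K V)"
  by (simp add: unitary_matrix_def conj_transpose_kronecker kronecker_mult kronecker_mat_1)

section \<open>Functional calculus of a Kronecker product\<close>

text \<open>The eigenvalue of \<open>A \<otimes> B\<close> on the product of two eigenvectors is the product \<open>x y\<close> of the
  eigenvalues, and \<open>f\<close> turns it into \<open>f x f y\<close>.\<close>

lemma hermitian_fun_kronecker: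
  assumes "conj_transpose A = A" "conj_transpose B = B"
    and mult: "\<And>x y. f (x * y) = f x * f y"
  shows "hermitian_fun f (A \<otimes>\<^sub>K B) = hermitian_fun f A \<otimes>\<^sub>K hermitian_fun f B"
proof -
  obtain U d where U: "unitary_matrix U" "A = U ** real_diag d ** conj_transpose U"
    using assms(1) by (rule hermitian_diagonalization)
  obtain V e where V: "unitary_matrix V" "B = V ** real_diag e ** conj_transpose V"
    using assms(2) by (rule hermitian_diagonalization)
  let ?W = "U \<otimes>\<^sub>K V"
  have "A \<otimes>\<^sub>K B = ?W ** real_diag (\<lambda>p. d (fst p) * e (snd p)) ** conj_transpose ?W"
    by (simp add: U(2) V(2) conj_transpose_kronecker kronecker_mult flip: kronecker_real_diag)
  then have "hermitian_fun f (A \<otimes>\<^sub>K B)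
      = ?W ** real_diag (f \<circ> (\<lambda>p. d (fst p) * e (snd p))) ** conj_transpose ?W"
    by (rule hermitian_fun_eqI[OF unitary_matrix_kronecker[OF U(1) V(1)]])
  also have "f \<circ> (\<lambda>p. d (fst p) * e (snd p)) = (\<lambda>p. (f \<circ> d) (fst p) * (f \<circ> e) (snd p))"
    by (auto simp: mult)
  also have "?W ** real_diag \<dots> ** conj_transpose ?W
      = hermitian_fun f A \<otimes>\<^sub>K hermitian_fun f B"
    by (simp only: hermitian_fun_eqI[OF U] hermitian_fun_eqI[OF V] conj_transpose_kronecker
        kronecker_mult flip: kronecker_real_diag)
  finally show ?thesis .
qed

text \<open>Real powers are defined through \<open>ln \<bar>x\<bar>\<close>, so \<open>x \<mapsto> x powr s\<close> is multiplicative on all reals and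
  \<open>hermitian_fun_kronecker\<close> applies whatever the signs of the eigenvalues. The exponent \<open>0\<close> is a case of its own, since the zeroth power is the identity
  even on the kernel.\<close>

lemma psd_powr_kronecker:
  assumes "conj_transpose A = A" "conj_transpose B = B"
  shows "psd_powr (A \<otimes>\<^sub>K B) s = psd_powr A s \<otimes>\<^sub>K psd_powr B s"
  by (simp add: psd_powr_def kronecker_mat_1 hermitian_fun_kronecker[OF assms powr_mult])

text \<open>A value of \<open>powr\<close> is never negative, so a power of a Hermitian matrix has nonnegative
  eigenvalues. This is the form in which the positivity of the powers enters
  \<open>trace_psd_mult_nonneg\<close>.\<close>

lemma psd_powr_diagonalization:
  fixes A :: "complex^'n^'n"
  assumes "conj_transpose A = A"
  obtains U d where "unitary_matrix U" "\<forall>k. 0 \<le> d k"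
    "psd_powr A s = U ** real_diag d ** conj_transpose U"
proof -
  obtain U e where U: "unitary_matrix U" "A = U ** real_diag e ** conj_transpose U"
    using assms by (rule hermitian_diagonalization)
  show ?thesis
  proof (cases "s = 0")
    case True
    have one: "real_diag (\<lambda>_ :: 'n. 1) = mat 1"
      by (simp add: vec_eq_iff real_diag_def mat_def)
    have "psd_powr A s = U ** real_diag (\<lambda>_. 1) ** conj_transpose U"
      using True U(1) unfolding one by (simp add: psd_powr_def unitary_matrix_def)
    then show ?thesis using that[OF U(1), of "\<lambda>_. 1"] by simp
  next
    case False
    then show ?thesis
      using that[OF U(1), of "(\<lambda>x. x powr s) \<circ> e"] hermitian_fun_eqI[OF U, of "\<lambda>x. x powr s"]
      by (simp add: psd_powr_def)
  qed
qed

lemma hermitian_psd_powr: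
  assumes "conj_transpose A = A"
  shows "conj_transpose (psd_powr A s) = psd_powr A s"
proof -
  obtain U d where "unitary_matrix U" "\<forall>k. 0 \<le> d k"
    "psd_powr A s = U ** real_diag d ** conj_transpose U"
    using assms by (rule psd_powr_diagonalization[where s = s])
  then show ?thesis
    by (simp add: conj_transpose_conj_transpose conj_transpose_mult conj_transpose_real_diag
        matrix_mul_assoc)
qed

section \<open>Multiplicativity and positivity of the fidelity\<close>

lemma hermitian_sandwich:
  assumes "conj_transpose A = A" "conj_transpose B = B"
  shows "conj_transpose (A ** B ** A) = A ** B ** A"
  by (simp add: assms conj_transpose_mult matrix_mul_assoc)

lemma hermitian_inverse_geometric_mean:
  assumes "conj_transpose \<rho> = \<rho>" "conj_transpose \<sigma> = \<sigma>"
  shows "conj_transpose (inverse_geometric_mean \<rho> \<sigma>) = inverse_geometric_mean \<rho> \<sigma>"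
  unfolding inverse_geometric_mean_def
  by (intro hermitian_sandwich hermitian_psd_powr assms)

lemma inverse_geometric_mean_kronecker:
  assumes "conj_transpose \<rho>1 = \<rho>1" "conj_transpose \<sigma>1 = \<sigma>1"
    and "conj_transpose \<rho>2 = \<rho>2" "conj_transpose \<sigma>2 = \<sigma>2"
  shows "inverse_geometric_mean (\<rho>1 \<otimes>\<^sub>K \<rho>2) (\<sigma>1 \<otimes>\<^sub>K \<sigma>2)
    = inverse_geometric_mean \<rho>1 \<sigma>1 \<otimes>\<^sub>K inverse_geometric_mean \<rho>2 \<sigma>2"
  by (simp add: inverse_geometric_mean_def psd_powr_kronecker kronecker_mult assms
      hermitian_sandwich hermitian_psd_powr)

lemma spectral_fidelity_kronecker:
  assumes "conj_transpose \<rho>1 = \<rho>1" "conj_transpose \<sigma>1 = \<sigma>1"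
    and "conj_transpose \<rho>2 = \<rho>2" "conj_transpose \<sigma>2 = \<sigma>2"
  shows "spectral_fidelity t (\<rho>1 \<otimes>\<^sub>K \<rho>2) (\<sigma>1 \<otimes>\<^sub>K \<sigma>2)
    = spectral_fidelity t \<rho>1 \<sigma>1 * spectral_fidelity t \<rho>2 \<sigma>2"
  by (simp add: spectral_fidelity_def inverse_geometric_mean_kronecker psd_powr_kronecker
      hermitian_inverse_geometric_mean kronecker_mult trace_kronecker assms)

text \<open>If the columns of \<open>U\<close> are \<open>u\<^sub>k\<close>, then by cyclicity the trace is
  \<open>\<Sum>k. d k \<langle>u\<^sub>k, A u\<^sub>k\<rangle>\<close>, a sum of nonnegative numbers.\<close>

lemma trace_psd_mult_nonneg:
  assumes psd: "positive_semidefinite A" and d: "\<And>k. 0 \<le> d k"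
  shows "0 \<le> trace (A ** (U ** real_diag d ** conj_transpose U))"
proof -
  have "trace (A ** (U ** real_diag d ** conj_transpose U))
      = trace ((conj_transpose U ** A ** U) ** real_diag d)"
    using trace_mul_sym[of "A ** U ** real_diag d" "conj_transpose U"]
    by (simp add: matrix_mul_assoc)
  also have "\<dots> = (\<Sum>k\<in>UNIV. (conj_transpose U ** A ** U) $ k $ k * of_real (d k))"
    by (simp add: trace_def mult_real_diag)
  also have "0 \<le> \<dots>"
  proof (intro sum_nonneg mult_nonneg_nonneg)
    fix k
    have "(conj_transpose U ** A ** U) $ k $ k
        = (\<Sum>j\<in>UNIV. \<Sum>i\<in>UNIV. cnj (U $ i $ k) * A $ i $ j * U $ j $ k)"
      by (simp add: matrix_matrix_mult_def conj_transpose_def sum_distrib_right)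
    also have "\<dots> = (\<Sum>i\<in>UNIV. \<Sum>j\<in>UNIV. cnj (U $ i $ k) * A $ i $ j * U $ j $ k)"
      by (rule sum.swap)
    also have "\<dots> = (\<Sum>i\<in>UNIV. \<Sum>j\<in>UNIV.
        cnj (column k U $ i) * A $ i $ j * column k U $ j)"
      by (simp add: column_def)
    also have "0 \<le> \<dots>" using psd unfolding positive_semidefinite_def by blast
    finally show "0 \<le> (conj_transpose U ** A ** U) $ k $ k" .
    show "0 \<le> complex_of_real (d k)" using d by (simp add: less_eq_complex_def)
  qed
  finally show ?thesis .
qed

lemma spectral_fidelity_nonneg:
  fixes \<rho> \<sigma> :: "complex^'n^'n"
  assumes "positive_semidefinite \<rho>" "conj_transpose \<sigma> = \<sigma>"
  shows "0 \<le> spectral_fidelity t \<rho> \<sigma>"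
proof -
  have "conj_transpose \<rho> = \<rho>" using assms(1) by (simp add: positive_semidefinite_def)
  then have herm: "conj_transpose (inverse_geometric_mean \<rho> \<sigma>) = inverse_geometric_mean \<rho> \<sigma>"
    using assms(2) by (rule hermitian_inverse_geometric_mean)
  obtain U d where "unitary_matrix U" and d: "\<forall>k. 0 \<le> d k" and P:
    "psd_powr (inverse_geometric_mean \<rho> \<sigma>) (2 * t) = U ** real_diag d ** conj_transpose U"
    using herm by (rule psd_powr_diagonalization[where s = "2 * t"])
  show ?thesis
    unfolding spectral_fidelity_def P by (rule trace_psd_mult_nonneg[OF assms(1) d[rule_format]])
qed

text \<open>For the second part, write the fidelities as nonnegative reals \<open>a\<close> and \<open>b\<close>. If both are
  positive, then \<open>ln (a b) = ln a + ln b\<close>; if one vanishes, so does \<open>a b\<close>, and both sides are \<open>\<infinity>\<close>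
  because \<open>- ln\<close> of a fidelity is never \<open>-\<infinity>\<close>.\<close>

theorem proposition3p4:
  fixes t :: real
    and \<rho>1 \<sigma>1 :: "complex^'n^'n"
    and \<rho>2 \<sigma>2 :: "complex^'m^'m"
  assumes "0 \<le> t" and "t \<le> 1"
    and "density_matrix \<rho>1" and "density_matrix \<sigma>1"
    and "density_matrix \<rho>2" and "density_matrix \<sigma>2"
  shows "spectral_fidelity t (\<rho>1 \<otimes>\<^sub>K \<rho>2) (\<sigma>1 \<otimes>\<^sub>K \<sigma>2)
           = spectral_fidelity t \<rho>1 \<sigma>1 * spectral_fidelity t \<rho>2 \<sigma>2
       \<and> neg_log_spectral_fidelity t (\<rho>1 \<otimes>\<^sub>K \<rho>2) (\<sigma>1 \<otimes>\<^sub>K \<sigma>2)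
           = neg_log_spectral_fidelity t \<rho>1 \<sigma>1 + neg_log_spectral_fidelity t \<rho>2 \<sigma>2"
proof
  have psd: "positive_semidefinite \<rho>1" "positive_semidefinite \<rho>2"
    and herm: "conj_transpose \<rho>1 = \<rho>1" "conj_transpose \<sigma>1 = \<sigma>1"
      "conj_transpose \<rho>2 = \<rho>2" "conj_transpose \<sigma>2 = \<sigma>2"
    using assms by (auto simp: density_matrix_def positive_semidefinite_def)
  show eq: "spectral_fidelity t (\<rho>1 \<otimes>\<^sub>K \<rho>2) (\<sigma>1 \<otimes>\<^sub>K \<sigma>2)
      = spectral_fidelity t \<rho>1 \<sigma>1 * spectral_fidelity t \<rho>2 \<sigma>2"
    by (rule spectral_fidelity_kronecker[OF herm])
  obtain a b where ab: "0 \<le> a" "0 \<le> b" "spectral_fidelity t \<rho>1 \<sigma>1 = complex_of_real a"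
      "spectral_fidelity t \<rho>2 \<sigma>2 = complex_of_real b"
    using spectral_fidelity_nonneg[OF psd(1) herm(2), of t]
      spectral_fidelity_nonneg[OF psd(2) herm(4), of t]
    that[of "Re (spectral_fidelity t \<rho>1 \<sigma>1)" "Re (spectral_fidelity t \<rho>2 \<sigma>2)"]
    by (simp add: less_eq_complex_def complex_eq_iff)
  show "neg_log_spectral_fidelity t (\<rho>1 \<otimes>\<^sub>K \<rho>2) (\<sigma>1 \<otimes>\<^sub>K \<sigma>2)
      = neg_log_spectral_fidelity t \<rho>1 \<sigma>1 + neg_log_spectral_fidelity t \<rho>2 \<sigma>2"
    using ab(1,2) by (auto simp: neg_log_spectral_fidelity_def eq ab(3,4) ln_mult)
qed

end
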